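(* Let $q$ be a prime power and let $PG_2(q)$ be a projective plane of order $q$. Then the flag graph $Flag(PG_2(q))$ is $2$-connected, geodetic, and has diameter $4$.
   Context: A projective plane of order $q$ is an incidence structure of points and lines in which any two distinct points lie on a unique common line, any two distinct lines meet in a unique point, there are four points no three of which are collinear, and every line has exactly $q+1$ points. It then has $q^2+q+1$ points and as many lines, and every point lies on $q+1$ lines. For an incidence structure $\mathcal{S}=(P,\mathcal{L},\mathcal{I})$ with point set $P$, line set $\mathcal{L}$ and incidence relation $\mathcal{I}\subset P\times\mathcal{L}$, elements of $\mathcal{I}$ are called flags. The flag graph $Flag(\mathcal{S})$ is the simple undirected graph with vertex set $P\sqcup\mathcal{I}$ and two kinds of edges: each point $p$ is adjacent to each flag $(p,L)\in\mathcal{I}$; and $(p,L)$ is adjacent to $(p',L)$ for every two distinct points $p,p'$ of the same line $L$. A graph is geodetic if between any two of its vertices there exists a unique shortest path. *)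

theory Defs
  imports
    "Graph_Theory.Graph_Theory"
    "HOL-Number_Theory.Prime_Powers"
begin

locale incidence_structure =
  fixes P :: "'p set" and L :: "'l set" and I :: "('p \<times> 'l) set"
  assumes incidence: "I \<subseteq> P \<times> L"

locale projective_plane_of_order = incidence_structure P L I
  for P :: "'p set" and L :: "'l set" and I :: "('p \<times> 'l) set" +
  fixes q :: nat
  assumes joining_line:
      "\<lbrakk>p \<in> P; p' \<in> P; p \<noteq> p'\<rbrakk> \<Longrightarrow> \<exists>!l. l \<in> L \<and> (p, l) \<in> I \<and> (p', l) \<in> I"
    and meeting_point:
      "\<lbrakk>l \<in> L; l' \<in> L; l \<noteq> l'\<rbrakk> \<Longrightarrow> \<exists>!p. p \<in> P \<and> (p, l) \<in> I \<and> (p, l') \<in> I"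
    and quadrangle:
      "\<exists>Q \<subseteq> P. card Q = 4 \<and>
         (\<forall>T \<subseteq> Q. card T = 3 \<longrightarrow> \<not> (\<exists>l \<in> L. \<forall>p \<in> T. (p, l) \<in> I))"
    and line_size:
      "l \<in> L \<Longrightarrow> card {p \<in> P. (p, l) \<in> I} = q + 1"

text \<open>An undirected edge is represented by its two opposite arcs.\<close>

definition flag_graph ::
    "'p set \<Rightarrow> ('p \<times> 'l) set \<Rightarrow> ('p + 'p \<times> 'l) pair_pre_digraph" where
  "flag_graph P I =
     \<lparr> pverts = P <+> I,
       parcs = {(Inl p, Inr (p, l)) |p l. (p, l) \<in> I}
             \<union> {(Inr (p, l), Inl p) |p l. (p, l) \<in> I}
             \<union> {(Inr (p, l), Inr (p', l)) |p p' l. (p, l) \<in> I \<and> (p', l) \<in> I \<and> p \<noteq> p'} \<rparr>"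

lemma (in incidence_structure) pair_bidirected_digraph_flag_graph:
  "pair_bidirected_digraph (flag_graph P I)"
proof -
  have "sym (parcs (flag_graph P I))"
    by (rule symI) (auto simp: flag_graph_def)
  moreover have "arcs_ends (with_proj (flag_graph P I)) = parcs (flag_graph P I)"
    by (simp add: arcs_ends_def arc_to_ends_def)
  ultimately have "symmetric (with_proj (flag_graph P I))"
    by (simp add: symmetric_def)
  then show ?thesis
    using incidence by unfold_locales (auto simp: flag_graph_def)
qed

text \<open>The cardinality bound forces the vertex set to be finite, since \<open>card\<close> is 0 on
  infinite sets.\<close>

definition k_connected :: "nat \<Rightarrow> ('a, 'b) pre_digraph \<Rightarrow> bool" where
  "k_connected k G \<longleftrightarrow>
     k < card (verts G) \<and>
     (\<forall>X \<subseteq> verts G. card X < k \<longrightarrow> Digraph_Component.connected (G \<restriction> (verts G - X)))"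

definition shortest_path :: "('a, 'b) pre_digraph \<Rightarrow> 'a \<Rightarrow> 'b awalk \<Rightarrow> 'a \<Rightarrow> bool" where
  "shortest_path G u p v \<longleftrightarrow>
     pre_digraph.apath G u p v \<and>
     (\<forall>p'. pre_digraph.apath G u p' v \<longrightarrow> length p \<le> length p')"

text \<open>Paths are lists of arcs, so this is the usual notion only for graphs without
  parallel arcs.\<close>

definition geodetic :: "('a, 'b) pre_digraph \<Rightarrow> bool" where
  "geodetic G \<longleftrightarrow> (\<forall>u \<in> verts G. \<forall>v \<in> verts G. \<exists>!p. shortest_path G u p v)"

text \<open>The distance is the library's minimal walk cost with all arcs of cost 1; it is
  \<open>\<infinity>\<close> for vertices in different components.\<close>

definition graph_dist :: "('a, 'b) pre_digraph \<Rightarrow> 'a \<Rightarrow> 'a \<Rightarrow> ereal" where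
  "graph_dist G u v = wf_digraph.\<mu> G (\<lambda>_. 1) u v"

definition graph_diameter :: "('a, 'b) pre_digraph \<Rightarrow> ereal" where
  "graph_diameter G = (SUP u \<in> verts G. SUP v \<in> verts G. graph_dist G u v)"

end

theory Submission
  imports Defs
begin

text \<open>Distances in the flag graph can be written down explicitly. Moving within a line costs
  one step and changing the line costs a detour through a point, so a vertex \<open>u\<close> reaches \<open>v\<close>
  cheaply exactly when few changes of line are forced: two distinct points are at distance 3 (enter
  their joining line, move along it, leave it), and the worst case, distance 4, occurs for a point
  and a flag on a line missing it, and for two flags \<open>(a,l)\<close>, \<open>(b,m)\<close> on distinct lines whose
  meeting point is neither \<open>a\<close> nor \<open>b\<close>. The function \<open>flag_dist\<close> records these values.

  That it is the distance, and that geodesics are unique, follow from one local property: along an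
  arc the value drops by at most one, and from every vertex other than the target exactly one arc
  makes it drop. Such a function is called a distance certificate below. A shortest walk must
  follow a dropping arc at each step, so there is only one. In the flag graph the uniqueness of the
  dropping arc comes from that of joining lines and meeting points in the plane.

  For 2-connectedness, removing a single vertex \<open>x\<close> spoils the walk of length 3 between
  two remaining points \<open>a\<close>, \<open>b\<close> only if \<open>x\<close> is a flag on their joining line; the detour through a
  third point off that line then avoids \<open>x\<close>. Each remaining flag still reaches a remaining point,
  because its line carries at least two points.\<close>

section \<open>Distance certificates\<close>

locale distance_certificate = wf_digraph G for G :: "('a, 'b) pre_digraph" (structure) +
  fixes v :: 'a and D :: "'a \<Rightarrow> nat"
  assumes target: "v \<in> verts G"
    and zero_at_target: "D v = 0"
    and drop_le_1: "e \<in> arcs G \<Longrightarrow> D (tail G e) \<le> D (head G e) + 1"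
    and unique_drop: "\<lbrakk>u \<in> verts G; u \<noteq> v\<rbrakk> \<Longrightarrow>
      \<exists>!e. e \<in> arcs G \<and> tail G e = u \<and> D u = D (head G e) + 1"
begin

lemma le_length_awalk: "awalk u p v \<Longrightarrow> D u \<le> length p"
proof (induction p arbitrary: u)
  case Nil
  then show ?case by (simp add: awalk_Nil_iff zero_at_target)
next
  case (Cons e p)
  then have e: "e \<in> arcs G" "u = tail G e" and "awalk (head G e) p v"
    by (auto simp: awalk_Cons_iff)
  then show ?case
    using Cons.IH drop_le_1[OF e(1)] by force
qed

text \<open>Following the dropping arcs leads to the target. The values along this walk decrease
  strictly, so no vertex is repeated; the bound on the values is what carries this through the
  induction.\<close>

lemma ex_descending_apath:
  assumes "u \<in> verts G"
  shows "\<exists>p. apath u p v \<and> length p = D u \<and> (\<forall>x \<in> set (awalk_verts u p). D x \<le> D u)"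
  using assms
proof (induction "D u" arbitrary: u)
  case 0
  then have "u = v" using unique_drop[OF 0(2)] by fastforce
  then show ?case
    using 0 by (intro exI[of _ "[]"]) (auto simp: apath_Nil_iff)
next
  case (Suc n)
  then have "u \<noteq> v" using zero_at_target by auto
  then obtain e where e: "e \<in> arcs G" "tail G e = u" "D u = D (head G e) + 1"
    using unique_drop[OF Suc.prems] by blast
  then obtain p where p: "apath (head G e) p v" "length p = D (head G e)"
      "\<forall>x \<in> set (awalk_verts (head G e) p). D x \<le> D (head G e)"
    using Suc.hyps by force
  have "u \<notin> set (awalk_verts (head G e) p)"
    using p(3) e(3) by force
  then show ?case
    using e p by (intro exI[of _ "e # p"]) (auto simp: apath_Cons_iff)
qed

text \<open>A walk of length \<open>D u\<close> has no slack: each arc can lower \<open>D\<close> by at most one, so every arc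
  of it is the dropping arc at its tail.\<close>

lemma shortest_awalk_unique:
  "\<lbrakk>awalk u p v; awalk u p' v; length p = D u; length p' = D u\<rbrakk> \<Longrightarrow> p = p'"
proof (induction p arbitrary: u p')
  case Nil
  then show ?case by simp
next
  case (Cons e p)
  then obtain e' r where p': "p' = e' # r" by (cases p') auto
  have arcs: "e \<in> arcs G" "tail G e = u" "e' \<in> arcs G" "tail G e' = u"
    and walks: "awalk (head G e) p v" "awalk (head G e') r v"
    using Cons.prems p' by (auto simp: awalk_Cons_iff)
  have drops: "D u = D (head G e) + 1" "D u = D (head G e') + 1"
    using arcs drop_le_1[OF arcs(1)] drop_le_1[OF arcs(3)] le_length_awalk[OF walks(1)]
      le_length_awalk[OF walks(2)] Cons.prems(3,4) p' by auto
  moreover have "u \<in> verts G" "u \<noteq> v"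
    using arcs drops zero_at_target by auto
  ultimately have "e = e'"
    using unique_drop arcs by blast
  moreover from this have "p = r"
    using Cons.IH[OF walks(1)] walks Cons.prems(3,4) p' drops by simp
  ultimately show ?case using p' by simp
qed

lemma shortest_path_iff:
  assumes "u \<in> verts G"
  shows "shortest_path G u p v \<longleftrightarrow> apath u p v \<and> length p = D u"
proof -
  have "D u \<le> length p'" if "apath u p' v" for p'
    using that le_length_awalk by (simp add: apath_def)
  then show ?thesis
    using ex_descending_apath[OF assms] unfolding shortest_path_def
    by (metis order_antisym)
qed

lemma ex1_shortest_path:
  assumes "u \<in> verts G"
  shows "\<exists>!p. shortest_path G u p v"
  using ex_descending_apath[OF assms] shortest_awalk_unique
  unfolding shortest_path_iff[OF assms] by (metis awalkI_apath)

lemma graph_dist_eq: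
  assumes "u \<in> verts G"
  shows "graph_dist G u v = ereal (D u)"
proof -
  have cost: "awalk_cost (\<lambda>_. 1) p = length p" for p :: "'b awalk"
    by (induction p) auto
  obtain p where "awalk u p v" "length p = D u"
    using ex_descending_apath[OF assms] by (metis awalkI_apath)
  then show ?thesis
    unfolding graph_dist_def \<mu>_def cost
    by (intro antisym INF_greatest INF_lower2[of p]) (auto dest: le_length_awalk)
qed

end

section \<open>Projective planes\<close>

context projective_plane_of_order
begin

lemma incident_in: "(p, l) \<in> I \<Longrightarrow> p \<in> P" "(p, l) \<in> I \<Longrightarrow> l \<in> L"
  using incidence by auto

lemma line_eqI:
  "\<lbrakk>(a, l) \<in> I; (b, l) \<in> I; (a, m) \<in> I; (b, m) \<in> I; a \<noteq> b\<rbrakk> \<Longrightarrow> l = m"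
  using joining_line[of a b] incident_in by metis

lemma finite_line: "l \<in> L \<Longrightarrow> finite {p \<in> P. (p, l) \<in> I}"
  using line_size by (simp add: card_ge_0_finite)

text \<open>A line through all points would contain three points of a quadrangle.\<close>

lemma ex_point_off_line:
  assumes "l \<in> L"
  obtains p where "p \<in> P" "(p, l) \<notin> I"
proof -
  obtain Q where Q: "Q \<subseteq> P" "card Q = 4"
      "\<And>T. T \<subseteq> Q \<Longrightarrow> card T = 3 \<Longrightarrow> \<not> (\<exists>l \<in> L. \<forall>p \<in> T. (p, l) \<in> I)"
    using quadrangle by blast
  obtain T where "T \<subseteq> Q" "card T = 3"
    using obtain_subset_with_card_n[of 3 Q] Q(2) by auto
  then show thesis
    using Q(1) Q(3)[of T] assms that by blast
qed

lemma card_points_ge_4: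
  assumes "finite P"
  shows "4 \<le> card P"
proof -
  obtain Q where "Q \<subseteq> P" "card Q = 4"
    using quadrangle by blast
  then show ?thesis
    using card_mono[OF assms, of Q] by simp
qed

lemma ex_antiflag:
  obtains p l where "p \<in> P" "l \<in> L" "(p, l) \<notin> I"
proof -
  obtain Q where Q: "Q \<subseteq> P" "card Q = 4"
    using quadrangle by blast
  then obtain a b where "a \<in> P" "b \<in> P" "a \<noteq> b"
    by (metis card_le_Suc0_iff_eq card_eq_0_iff numeral_le_one_iff One_nat_def
        semiring_norm(69) subsetD zero_neq_numeral)
  then obtain l where "l \<in> L"
    using joining_line by blast
  then show thesis
    using ex_point_off_line that by blast
qed

text \<open>Projecting from a point \<open>p\<close> onto a line \<open>l\<close> missing it shows that every other point lies on
  one of the finitely many lines joining \<open>p\<close> to a point of \<open>l\<close>.\<close>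

lemma finite_points: "finite P"
proof -
  obtain p l where pl: "p \<in> P" "l \<in> L" "(p, l) \<notin> I"
    by (rule ex_antiflag)
  define S where "S = {r \<in> P. (r, l) \<in> I}"
  have "\<forall>r \<in> S. \<exists>m. m \<in> L \<and> (p, m) \<in> I \<and> (r, m) \<in> I"
    using joining_line pl unfolding S_def by blast
  then obtain j where j: "\<And>r. r \<in> S \<Longrightarrow> j r \<in> L \<and> (p, j r) \<in> I \<and> (r, j r) \<in> I"
    by metis
  have "x \<in> {p} \<union> (\<Union>r \<in> S. {y \<in> P. (y, j r) \<in> I})" if x: "x \<in> P" for x
  proof (cases "x = p")
    case False
    then obtain m where m: "m \<in> L" "(x, m) \<in> I" "(p, m) \<in> I"
      using joining_line[of x p] x pl by blast
    then obtain r where r: "r \<in> S" "(r, m) \<in> I"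
      using meeting_point[of m l] pl unfolding S_def by blast
    then have "m = j r"
      using line_eqI[of p m r "j r"] j m pl unfolding S_def by blast
    then show ?thesis using r m x by blast
  qed simp
  moreover have "finite ({p} \<union> (\<Union>r \<in> S. {y \<in> P. (y, j r) \<in> I}))"
    using finite_line pl j unfolding S_def by auto
  ultimately show ?thesis
    by (meson finite_subset subsetI)
qed

lemma ex_point_on_line:
  assumes "l \<in> L"
  obtains p where "(p, l) \<in> I"
proof -
  have "card {p \<in> P. (p, l) \<in> I} \<noteq> card {}"
    using line_size[OF assms] by simp
  then have "{p \<in> P. (p, l) \<in> I} \<noteq> {}" by metis
  then show thesis using that by blast
qed

lemma ex_other_point:
  assumes "0 < q" "(a, l) \<in> I"
  obtains b where "(b, l) \<in> I" "b \<noteq> a"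
proof -
  have "card {p \<in> P. (p, l) \<in> I} \<noteq> card {a}"
    using line_size incident_in assms by fastforce
  then have "{p \<in> P. (p, l) \<in> I} \<noteq> {a}" by metis
  then show thesis using that assms incident_in by blast
qed

text \<open>Lines with at least two points are determined by their point sets.\<close>

lemma finite_lines:
  assumes "0 < q"
  shows "finite L"
proof (rule inj_on_finite[where B = "Pow P" and f = "\<lambda>l. {p \<in> P. (p, l) \<in> I}"])
  show "inj_on (\<lambda>l. {p \<in> P. (p, l) \<in> I}) L"
  proof (rule inj_onI, rule ccontr)
    fix l m assume lm: "l \<in> L" "m \<in> L" "{p \<in> P. (p, l) \<in> I} = {p \<in> P. (p, m) \<in> I}" "l \<noteq> m"
    then obtain a where a: "(a, l) \<in> I"
      using meeting_point by blast
    then obtain b where "(b, l) \<in> I" "b \<noteq> a"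
      using ex_other_point assms by blast
    moreover from this have "(a, m) \<in> I" "(b, m) \<in> I"
      using a lm(3) incident_in by blast+
    ultimately show False
      using a lm(4) line_eqI[of a l b m] by simp
  qed
qed (use finite_points in auto)

section \<open>Distances in the flag graph\<close>

abbreviation "F \<equiv> flag_graph P I"

lemma verts_flag_graph: "pverts F = P <+> I"
  by (simp add: flag_graph_def)

lemma flag_graph_arcs [simp]:
  "(Inl a, Inl b) \<notin> parcs F"
  "(Inl a, Inr (b, l)) \<in> parcs F \<longleftrightarrow> a = b \<and> (b, l) \<in> I"
  "(Inr (b, l), Inl a) \<in> parcs F \<longleftrightarrow> a = b \<and> (b, l) \<in> I"
  "(Inr (a, l), Inr (b, m)) \<in> parcs F \<longleftrightarrow> l = m \<and> (a, l) \<in> I \<and> (b, l) \<in> I \<and> a \<noteq> b"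
  by (auto simp: flag_graph_def)

fun flag_dist :: "'p + 'p \<times> 'l \<Rightarrow> 'p + 'p \<times> 'l \<Rightarrow> nat" where
  "flag_dist (Inl a) (Inl b) = (if a = b then 0 else 3)"
| "flag_dist (Inl a) (Inr (b, m)) = (if a = b then 1 else if (a, m) \<in> I then 2 else 4)"
| "flag_dist (Inr (a, l)) (Inl b) = (if a = b then 1 else if (b, l) \<in> I then 2 else 4)"
| "flag_dist (Inr (a, l)) (Inr (b, m)) =
    (if l = m then (if a = b then 0 else 1)
     else if a = b then 2
     else if (a, m) \<in> I \<or> (b, l) \<in> I then 3
     else 4)"

lemma flag_dist_le_4: "flag_dist u v \<le> 4"
  by (cases "(u, v)" rule: flag_dist.cases) auto

lemma vertex_cases:
  assumes "u \<in> pverts F"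
  obtains (point) a where "u = Inl a" "a \<in> P"
    | (flag) a l where "u = Inr (a, l)" "(a, l) \<in> I"
  using assms by (auto simp: verts_flag_graph)

lemma flag_dist_drop_le_1:
  assumes "v \<in> pverts F" "(u, w) \<in> parcs F"
  shows "flag_dist u v \<le> flag_dist w v + 1"
  using assms(1)
proof (cases rule: vertex_cases)
  case (point b)
  then show ?thesis
    using assms(2) by (cases "(u, w)" rule: flag_dist.cases) (auto dest: line_eqI)
next
  case (flag b m)
  then show ?thesis
    using assms(2) by (cases "(u, w)" rule: flag_dist.cases) (auto dest: line_eqI)
qed

text \<open>From a point, the next vertex on a geodesic is a flag, and it is determined by the uniqueness of
  the line joining the point to the target. From a flag one either leaves its line or moves to the
  point at which the line is left; towards a flag on another line this is the meeting point of the
  two lines, and its uniqueness determines the step.\<close>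

lemma unique_drop_to_point:
  assumes b: "b \<in> P" and u: "u \<in> pverts F" "u \<noteq> Inl b"
  shows "\<exists>!w. (u, w) \<in> parcs F \<and> flag_dist u (Inl b) = flag_dist w (Inl b) + 1"
  using u(1)
proof (cases rule: vertex_cases)
  case (point a)
  with u(2) have "a \<noteq> b" by simp
  then obtain l where l: "(a, l) \<in> I" "(b, l) \<in> I"
    using joining_line b point by blast
  show ?thesis
  proof (rule ex1I[of _ "Inr (a, l)"])
    fix w assume "(u, w) \<in> parcs F \<and> flag_dist u (Inl b) = flag_dist w (Inl b) + 1"
    then show "w = Inr (a, l)"
      using point l \<open>a \<noteq> b\<close>
      by (cases w) (auto split: if_splits dest: line_eqI)
  qed (use point l \<open>a \<noteq> b\<close> in auto)
next
  case (flag a l)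
  \<comment> \<open>Stay on \<open>l\<close> and move to \<open>b\<close> if possible; otherwise leave \<open>l\<close> at once.\<close>
  define w where "w = (if a \<noteq> b \<and> (b, l) \<in> I then Inr (b, l) else Inl a)"
  show ?thesis
  proof (rule ex1I[of _ w])
    fix w' assume "(u, w') \<in> parcs F \<and> flag_dist u (Inl b) = flag_dist w' (Inl b) + 1"
    then show "w' = w"
      using flag unfolding w_def by (cases w') (auto split: if_splits)
  qed (use flag w_def in auto)
qed

lemma unique_drop_to_flag:
  assumes bm: "(b, m) \<in> I" and u: "u \<in> pverts F" "u \<noteq> Inr (b, m)"
  shows "\<exists>!w. (u, w) \<in> parcs F \<and> flag_dist u (Inr (b, m)) = flag_dist w (Inr (b, m)) + 1"
  using u(1)
proof (cases rule: vertex_cases)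
  case (point a)
  \<comment> \<open>Enter the line \<open>m\<close> itself if possible, otherwise the line towards \<open>b\<close>.\<close>
  obtain l where l: "(a, l) \<in> I" "(b, l) \<in> I" "(a, m) \<in> I \<Longrightarrow> l = m"
    using joining_line[of a b] bm point incident_in by metis
  show ?thesis
  proof (rule ex1I[of _ "Inr (a, l)"])
    fix w assume "(u, w) \<in> parcs F \<and>
      flag_dist u (Inr (b, m)) = flag_dist w (Inr (b, m)) + 1"
    then show "w = Inr (a, l)"
      using point l bm by (cases w) (auto split: if_splits dest: line_eqI)
  qed (use point l bm in \<open>auto dest: line_eqI\<close>)
next
  case (flag a l)
  show ?thesis
  proof (cases "l = m")
    case True
    then have "a \<noteq> b" using flag u(2) by simp
    show ?thesis
    proof (rule ex1I[of _ "Inr (b, m)"])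
      fix w assume "(u, w) \<in> parcs F \<and>
        flag_dist u (Inr (b, m)) = flag_dist w (Inr (b, m)) + 1"
      then show "w = Inr (b, m)"
        using flag True \<open>a \<noteq> b\<close> by (cases w) (auto split: if_splits)
    qed (use flag True \<open>a \<noteq> b\<close> bm in auto)
  next
    case False
    \<comment> \<open>A geodesic from \<open>l\<close> to \<open>m\<close> changes lines at the meeting point \<open>r\<close>.\<close>
    obtain r where r: "(r, l) \<in> I" "(r, m) \<in> I"
      using meeting_point[OF _ _ False] bm flag incident_in by metis
    have r_iff: "(c, m) \<in> I \<longleftrightarrow> c = r" if "(c, l) \<in> I" for c
      using that r False line_eqI[of c l r m] by auto
    have b_iff: "(b, l) \<in> I \<longleftrightarrow> b = r"
      using r r_iff[of b] bm by auto
    define w where "w = (if r = a then Inl a else Inr (r, l))"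
    show ?thesis
    proof (rule ex1I[of _ w])
      fix w' assume *: "(u, w') \<in> parcs F \<and>
        flag_dist u (Inr (b, m)) = flag_dist w' (Inr (b, m)) + 1"
      show "w' = w"
      proof (cases w')
        case (Inl c)
        then show ?thesis
          using * flag False b_iff r_iff[of a] unfolding w_def by (auto split: if_splits)
      next
        case (Inr c)
        then show ?thesis
          using * flag False b_iff r_iff[of a] r_iff[of "fst c"] unfolding w_def
          by (cases c) (auto split: if_splits)
      qed
    next
      show "(u, w) \<in> parcs F \<and> flag_dist u (Inr (b, m)) = flag_dist w (Inr (b, m)) + 1"
        using flag r False b_iff r_iff[of a] unfolding w_def by auto
    qed
  qed
qed

lemma flag_graph_certificate:
  assumes v: "v \<in> pverts F"
  shows "distance_certificate (with_proj F) v (\<lambda>u. flag_dist u v)"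
proof -
  interpret pair_bidirected_digraph F
    by (rule pair_bidirected_digraph_flag_graph)
  have uniq: "\<exists>!w. (u, w) \<in> parcs F \<and> flag_dist u v = flag_dist w v + 1"
    if "u \<in> pverts F" "u \<noteq> v" for u
    using v
    by (cases rule: vertex_cases) (use that unique_drop_to_point unique_drop_to_flag in simp_all)
  show ?thesis
  proof unfold_locales
    fix u assume "u \<in> verts (with_proj F)" "u \<noteq> v"
    then obtain w where w: "(u, w) \<in> parcs F" "flag_dist u v = flag_dist w v + 1"
      and w_unique: "\<And>w'. (u, w') \<in> parcs F \<Longrightarrow> flag_dist u v = flag_dist w' v + 1 \<Longrightarrow> w' = w"
      using uniq[of u] by auto
    then show "\<exists>!e. e \<in> arcs (with_proj F) \<and> tail (with_proj F) e = u \<and>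
        flag_dist u v = flag_dist (head (with_proj F) e) v + 1"
      by (intro ex1I[of _ "(u, w)"]) auto
  next
    show "flag_dist v v = 0"
      using v by (cases rule: vertex_cases) auto
  next
    fix e assume "e \<in> arcs (with_proj F)"
    then show "flag_dist (tail (with_proj F) e) v \<le> flag_dist (head (with_proj F) e) v + 1"
      using flag_dist_drop_le_1[OF v, of "fst e" "snd e"] by simp
  qed (use v in simp)
qed

lemma geodetic_flag_graph: "geodetic (with_proj F)"
  unfolding geodetic_def
  using distance_certificate.ex1_shortest_path[OF flag_graph_certificate] by simp

text \<open>The value 4 is attained at a point and a flag on a line missing it.\<close>

lemma graph_diameter_flag_graph:
  assumes "0 < q"
  shows "graph_diameter (with_proj F) = 4"
proof -
  have dist: "graph_dist (with_proj F) u v = ereal (flag_dist u v)"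
    if "u \<in> pverts F" "v \<in> pverts F" for u v
    using distance_certificate.graph_dist_eq[OF flag_graph_certificate] that by simp
  obtain p l where pl: "p \<in> P" "l \<in> L" "(p, l) \<notin> I"
    by (rule ex_antiflag)
  then obtain b where b: "(b, l) \<in> I"
    using ex_point_on_line by blast
  then have verts: "Inl p \<in> pverts F" "Inr (b, l) \<in> pverts F"
    using pl by (auto simp: verts_flag_graph)
  have "graph_dist (with_proj F) (Inl p) (Inr (b, l)) = 4"
    using dist[OF verts] pl b by auto
  moreover have "graph_dist (with_proj F) u v \<le> 4" if "u \<in> pverts F" "v \<in> pverts F" for u v
    using dist[OF that] flag_dist_le_4[of u v] by simp
  ultimately show ?thesis
    unfolding graph_diameter_def using verts
    by (intro antisym SUP_least SUP_upper2[of "Inl p"] SUP_upper2[of "Inr (b, l)"]) auto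
qed

section \<open>Connectedness after removing a vertex\<close>

text \<open>Removing nothing and removing one vertex are treated together as \<open>X \<subseteq> {x}\<close>. It is enough to
  connect the remaining points with each other and every remaining flag with some remaining
  point.\<close>

lemma connected_remove_vertex:
  assumes q: "0 < q" and X: "X \<subseteq> {x}"
  shows "Digraph_Component.connected (with_proj F \<restriction> (pverts F - X))"
proof -
  interpret pair_bidirected_digraph F
    by (rule pair_bidirected_digraph_flag_graph)
  define H where "H = with_proj F \<restriction> (pverts F - X)"
  interpret H: wf_digraph H
    unfolding H_def by (rule wellformed_induce_subgraph)
  have sym: "symmetric H"
    unfolding H_def
    using induced_graph_imp_symmetric[OF pair_sym_arcs] induced_induce by auto
  have verts: "verts H = pverts F - X"
    by (simp add: H_def)
  have adj: "u \<rightarrow>\<^sup>*\<^bsub>H\<^esub> w" if "(u, w) \<in> parcs F" "u \<notin> X" "w \<notin> X" for u w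
  proof (rule H.reachable_adjI)
    show "u \<rightarrow>\<^bsub>H\<^esub> w"
      using that arc_fst_in_verts[OF that(1)] arc_snd_in_verts[OF that(1)]
      unfolding arcs_ends_conv H_def induce_subgraph_def by force
  qed
  have along_line: "Inl a \<rightarrow>\<^sup>*\<^bsub>H\<^esub> Inl b"
    if l: "(a, l) \<in> I" "(b, l) \<in> I" "a \<noteq> b"
      and X: "Inl a \<notin> X" "Inl b \<notin> X" "Inr (a, l) \<notin> X" "Inr (b, l) \<notin> X" for a b l
  proof -
    have "Inl a \<rightarrow>\<^sup>*\<^bsub>H\<^esub> Inr (a, l)" "Inr (a, l) \<rightarrow>\<^sup>*\<^bsub>H\<^esub> Inr (b, l)" "Inr (b, l) \<rightarrow>\<^sup>*\<^bsub>H\<^esub> Inl b"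
      using l X by (auto intro!: adj)
    then show ?thesis by (meson H.reachable_trans)
  qed
  have points: "Inl a \<rightarrow>\<^sup>*\<^bsub>H\<^esub> Inl b"
    if ab: "a \<in> P" "b \<in> P" "Inl a \<notin> X" "Inl b \<notin> X" for a b
  proof (cases "a = b")
    case True
    then show ?thesis using ab by (auto simp: verts verts_flag_graph)
  next
    case False
    then obtain l where l: "(a, l) \<in> I" "(b, l) \<in> I"
      using joining_line ab by blast
    show ?thesis
    proof (cases "Inr (a, l) \<in> X \<or> Inr (b, l) \<in> X")
      case False
      then show ?thesis using along_line[OF l \<open>a \<noteq> b\<close>] ab by blast
    next
      case True
      \<comment> \<open>Since \<open>x\<close> is a flag on \<open>l\<close>, the other lines through \<open>a\<close> and \<open>b\<close> are intact; they are
        joined at a point \<open>c\<close> off \<open>l\<close>.\<close>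
      then have x: "x = Inr (a, l) \<or> x = Inr (b, l)"
        using X by auto
      obtain c where c: "c \<in> P" "(c, l) \<notin> I"
        using ex_point_off_line l incident_in by blast
      then have ne: "a \<noteq> c" "c \<noteq> b" using l by auto
      then obtain m n where mn: "(a, m) \<in> I" "(c, m) \<in> I" "(c, n) \<in> I" "(b, n) \<in> I"
        using joining_line[of a c] joining_line[of c b] ab c by blast
      then have "m \<noteq> l" "n \<noteq> l" using c by auto
      then have off: "Inl c \<notin> X" "Inr (y, m) \<notin> X" "Inr (y, n) \<notin> X" for y
        using x X by auto
      have "Inl a \<rightarrow>\<^sup>*\<^bsub>H\<^esub> Inl c" "Inl c \<rightarrow>\<^sup>*\<^bsub>H\<^esub> Inl b"
        using along_line mn ne off ab by blast+
      then show ?thesis by (rule H.reachable_trans)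
    qed
  qed
  have to_point: "\<exists>a \<in> P. Inl a \<notin> X \<and> u \<rightarrow>\<^sup>*\<^bsub>H\<^esub> Inl a" if u: "u \<in> verts H" for u
  proof -
    from u have "u \<in> pverts F" "u \<notin> X" by (auto simp: verts)
    from this(1) show ?thesis
    proof (cases rule: vertex_cases)
      case (point a)
      then show ?thesis using u \<open>u \<notin> X\<close> by blast
    next
      case (flag a l)
      show ?thesis
      proof (cases "Inl a \<in> X")
        case False
        then show ?thesis
          using flag \<open>u \<notin> X\<close> incident_in by (auto intro!: bexI[of _ a] adj)
      next
        case True
        then have x: "x = Inl a" using X by auto
        obtain c where c: "(c, l) \<in> I" "c \<noteq> a"
          using ex_other_point q flag by blast
        have "u \<rightarrow>\<^sup>*\<^bsub>H\<^esub> Inr (c, l)" "Inr (c, l) \<rightarrow>\<^sup>*\<^bsub>H\<^esub> Inl c"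
          using flag c x X \<open>u \<notin> X\<close> by (auto intro!: adj)
        moreover have "c \<in> P" "Inl c \<notin> X"
          using c x X incident_in by auto
        ultimately show ?thesis by (meson H.reachable_trans)
      qed
    qed
  qed
  have "u \<rightarrow>\<^sup>*\<^bsub>H\<^esub> w" if uw: "u \<in> verts H" "w \<in> verts H" for u w
  proof -
    obtain a where a: "a \<in> P" "Inl a \<notin> X" "u \<rightarrow>\<^sup>*\<^bsub>H\<^esub> Inl a"
      using to_point uw by blast
    obtain b where b: "b \<in> P" "Inl b \<notin> X" "w \<rightarrow>\<^sup>*\<^bsub>H\<^esub> Inl b"
      using to_point uw by blast
    show ?thesis
      using a(3) points[OF a(1) b(1) a(2) b(2)] symmetric_reachable[OF sym b(3)]
      by (meson H.reachable_trans)
  qed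
  moreover have "verts H \<noteq> {}"
  proof -
    obtain p l where pl: "p \<in> P" "l \<in> L" "(p, l) \<notin> I"
      by (rule ex_antiflag)
    obtain b where "(b, l) \<in> I"
      using ex_point_on_line pl(2) by blast
    then have "Inl p \<in> pverts F" "Inl b \<in> pverts F" "p \<noteq> b"
      using pl incident_in by (auto simp: verts_flag_graph)
    then show ?thesis using X unfolding verts by blast
  qed
  ultimately have "Digraph_Component.connected H"
    by (intro H.connectedI H.reachable_mk_symmetricI)
  then show ?thesis by (simp add: H_def)
qed

lemma two_connected_flag_graph:
  assumes "0 < q"
  shows "k_connected 2 (with_proj F)"
  unfolding k_connected_def
proof (intro conjI allI impI)
  have "finite I"
    using finite_subset[OF incidence] finite_points finite_lines[OF assms] by blast
  then have "card (pverts F) = card P + card I"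
    by (simp add: verts_flag_graph card_Plus finite_points)
  then show "2 < card (verts (with_proj F))"
    using card_points_ge_4[OF finite_points] by simp
  fix X assume X: "X \<subseteq> verts (with_proj F)" "card X < 2"
  have "finite (pverts F)"
    using \<open>finite I\<close> finite_points by (simp add: verts_flag_graph)
  then have "finite X"
    using X(1) finite_subset by auto
  then obtain x where "X \<subseteq> {x}"
    using X(2) by (metis card_le_Suc0_iff_eq less_2_cases_iff One_nat_def le_numeral_extra(4)
        zero_le subsetI singleton_iff)
  then show "Digraph_Component.connected (with_proj F \<restriction> (verts (with_proj F) - X))"
    using connected_remove_vertex[OF assms] by simp
qed

end

theorem theorem3p4:
  fixes P :: "'p set" and L :: "'l set" and I :: "('p \<times> 'l) set" and q :: nat
  assumes "primepow q"
    and "projective_plane_of_order P L I q"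
  shows "k_connected 2 (with_proj (flag_graph P I)) \<and>
         geodetic (with_proj (flag_graph P I)) \<and>
         graph_diameter (with_proj (flag_graph P I)) = 4"
proof -
  interpret projective_plane_of_order P L I q
    by (rule assms(2))
  have "0 < q"
    using assms(1) by (rule primepow_gt_0_nat)
  then show ?thesis
    using two_connected_flag_graph geodetic_flag_graph graph_diameter_flag_graph by blast
qed

end
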